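(* Let $\mathbb{F}$ be an algebraically closed field of characteristic $p>2$ and let $n\in\mathbb{N}$. Assume $(p,n)\neq(3,1)$. Given $q,q'\in\mathcal{W}(1;n)$, the algebras $\mathcal{W}_n(q)$ and $\mathcal{W}_n(q')$ are isomorphic if and only if there exists a Lie algebra automorphism $\Psi\in\mathrm{Aut}(\mathcal{W}(1;n))$ such that $$q'=\Psi(e_{-1})^{-2}\bullet\Psi(q),$$ where the power $\Psi(e_{-1})^{-2}$ is taken in $(\mathcal{W}(1;n),\bullet)$.
   Context: For $n\geq 1$, the divided powers algebra $\mathcal{O}(1;n)$ over $\mathbb{F}$ is the commutative associative unital algebra with basis $x^{(i)}$, $0\le i<p^n$, and multiplication $x^{(i)}x^{(j)}=\binom{i+j}{j}x^{(i+j)}$ with $x^{(k)}=0$ for $k\geq p^n$. Let $\partial$ be its derivation with $\partial(x^{(i)})=x^{(i-1)}$ ($\partial(x^{(0)})=0$). The Zassenhaus algebra is $\mathcal{W}(1;n)=\mathcal{O}(1;n)\partial$ with Lie bracket $[f\partial,g\partial]=(f\,\partial(g)-\partial(f)\,g)\partial$ and basis $e_i=x^{(i+1)}\partial$, $-1\le i\le p^n-2$. Let $\bullet$ be the commutative associative product on $\mathcal{W}(1;n)$ given by $(f\partial)\bullet(g\partial)=(fg)\partial$; its unit is $e_{-1}=\partial$. For $q\in\mathcal{W}(1;n)$, $\mathcal{W}_n(q)$ is the vector space $\mathcal{W}(1;n)$ with its Lie bracket and the associative commutative product $x\bullet_q y=x\bullet q\bullet y$; it is a transposed Poisson algebra (i.e.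 $2x\bullet_q[y,z]=[x\bullet_q y,z]+[y,x\bullet_q z]$). Isomorphisms of such algebras are linear bijections preserving both multiplications. Under the hypotheses, for every $\Psi\in\mathrm{Aut}(\mathcal{W}(1;n))$ the element $\Psi(e_{-1})$ is invertible in $(\mathcal{W}(1;n),\bullet)$. *)

theory Defs
  imports
    "HOL-Computational_Algebra.Computational_Algebra"
    "HOL-Algebra.Group"
begin

record ('k, 'v) lie_alg =
  vspace :: "'v set"
  vadd :: "'v \<Rightarrow> 'v \<Rightarrow> 'v"
  vscale :: "'k \<Rightarrow> 'v \<Rightarrow> 'v"
  bracket :: "'v \<Rightarrow> 'v \<Rightarrow> 'v"

record ('k, 'v) tp_alg = "('k, 'v) lie_alg" +
  tp_mult :: "'v \<Rightarrow> 'v \<Rightarrow> 'v"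

definition lie_iso ::
  "('k, 'v, 'm) lie_alg_scheme \<Rightarrow> ('k, 'w, 'l) lie_alg_scheme \<Rightarrow> ('v \<Rightarrow> 'w) \<Rightarrow> bool" where
  "lie_iso A B \<phi> \<longleftrightarrow>
     bij_betw \<phi> (vspace A) (vspace B) \<and>
     (\<forall>x\<in>vspace A. \<forall>y\<in>vspace A. \<phi> (vadd A x y) = vadd B (\<phi> x) (\<phi> y)) \<and>
     (\<forall>c. \<forall>x\<in>vspace A. \<phi> (vscale A c x) = vscale B c (\<phi> x)) \<and>
     (\<forall>x\<in>vspace A. \<forall>y\<in>vspace A. \<phi> (bracket A x y) = bracket B (\<phi> x) (\<phi> y))"

definition lie_aut :: "('k, 'v, 'm) lie_alg_scheme \<Rightarrow> ('v \<Rightarrow> 'v) set" where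
  "lie_aut A = {\<Psi>. lie_iso A A \<Psi>}"

definition tp_iso ::
  "('k, 'v, 'm) tp_alg_scheme \<Rightarrow> ('k, 'w, 'l) tp_alg_scheme \<Rightarrow> ('v \<Rightarrow> 'w) \<Rightarrow> bool" where
  "tp_iso A B \<phi> \<longleftrightarrow> lie_iso A B \<phi> \<and>
     (\<forall>x\<in>vspace A. \<forall>y\<in>vspace A. \<phi> (tp_mult A x y) = tp_mult B (\<phi> x) (\<phi> y))"

definition tp_isomorphic ::
  "('k, 'v, 'm) tp_alg_scheme \<Rightarrow> ('k, 'w, 'l) tp_alg_scheme \<Rightarrow> bool" where
  "tp_isomorphic A B \<longleftrightarrow> (\<exists>\<phi>. tp_iso A B \<phi>)"

text \<open>
  An element of the divided powers algebra is given by its coefficient function: \<open>f\<close> stands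
  for the sum of the \<open>f i\<close> times \<open>x\<^sup>(\<^sup>i\<^sup>)\<close> over \<open>i < p ^ n\<close>, where \<open>p = CHAR('a)\<close>.
\<close>

definition dp_space :: "nat \<Rightarrow> (nat \<Rightarrow> 'a::field) set" where
  "dp_space n = {f. \<forall>i \<ge> CHAR('a) ^ n. f i = 0}"

definition dp_basis :: "nat \<Rightarrow> nat \<Rightarrow> 'a::field" where
  "dp_basis i = (\<lambda>k. if k = i then 1 else 0)"

definition dp_mult :: "nat \<Rightarrow> (nat \<Rightarrow> 'a::field) \<Rightarrow> (nat \<Rightarrow> 'a) \<Rightarrow> nat \<Rightarrow> 'a" where
  "dp_mult n f g = (\<lambda>k. if k < CHAR('a) ^ n
     then \<Sum>j\<le>k. of_nat (k choose j) * f (k - j) * g j else 0)"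

definition dp_deriv :: "(nat \<Rightarrow> 'a::field) \<Rightarrow> nat \<Rightarrow> 'a" where
  "dp_deriv f = (\<lambda>k. f (Suc k))"

lemma dp_basis_in_space: "i < CHAR('a::field) ^ n \<Longrightarrow> (dp_basis i :: nat \<Rightarrow> 'a) \<in> dp_space n"
  by (auto simp: dp_basis_def dp_space_def)

lemma dp_mult_in_space: "dp_mult n f g \<in> dp_space n"
  by (auto simp: dp_mult_def dp_space_def)

lemma dp_deriv_in_space: "f \<in> dp_space n \<Longrightarrow> dp_deriv f \<in> dp_space n"
  by (auto simp: dp_deriv_def dp_space_def)

lemma dp_mult_basis:
  "dp_mult n (dp_basis i) (dp_basis j :: nat \<Rightarrow> 'a::field) =
     (\<lambda>k. if i + j < CHAR('a) ^ n then of_nat ((i + j) choose j) * dp_basis (i + j) k else 0)"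
proof
  fix k
  have "(\<Sum>l\<le>k. of_nat (k choose l) * dp_basis i (k - l) * dp_basis j l) =
        (\<Sum>l\<le>k. if l = j then of_nat (k choose j) * (dp_basis i (k - j) :: 'a) else 0)"
    by (rule sum.cong) (auto simp: dp_basis_def)
  also have "\<dots> = of_nat ((i + j) choose j) * dp_basis (i + j) k"
    by (auto simp: dp_basis_def)
  finally show "dp_mult n (dp_basis i) (dp_basis j :: nat \<Rightarrow> 'a) k =
     (if i + j < CHAR('a) ^ n then of_nat ((i + j) choose j) * dp_basis (i + j) k else 0)"
    by (auto simp: dp_mult_def dp_basis_def)
qed

lemma dp_mult_one_left: "f \<in> dp_space n \<Longrightarrow> dp_mult n (dp_basis 0) f = f"
proof
  fix k assume f: "f \<in> dp_space n"
  have "(\<Sum>j\<le>k. of_nat (k choose j) * dp_basis 0 (k - j) * f j) =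
        (\<Sum>j\<le>k. if j = k then f k else 0)"
    by (rule sum.cong) (auto simp: dp_basis_def)
  then show "dp_mult n (dp_basis 0) f k = f k"
    using f by (auto simp: dp_mult_def dp_space_def)
qed

lemma dp_mult_commute: "dp_mult n f g = dp_mult n g f"
proof
  fix k
  have "(\<Sum>j\<le>k. of_nat (k choose j) * f (k - j) * g j) =
        (\<Sum>j\<le>k. of_nat (k choose (k - j)) * f (k - (k - j)) * g (k - j))"
    by (rule sum.reindex_bij_witness[of _ "\<lambda>j. k - j" "\<lambda>j. k - j"]) auto
  also have "\<dots> = (\<Sum>j\<le>k. of_nat (k choose j) * g (k - j) * f j)"
    by (rule sum.cong) (auto simp: binomial_symmetric[symmetric] mult_ac)
  finally show "dp_mult n f g k = dp_mult n g f k"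
    by (simp add: dp_mult_def)
qed

lemma dp_mult_assoc: "dp_mult n (dp_mult n f g) h = dp_mult n f (dp_mult n g h)"
proof
  fix k
  define M where "M f g k = (\<Sum>j\<le>k. of_nat (k choose j) * f (k - j) * g j)"
    for f g :: "nat \<Rightarrow> 'a" and k
  define F where "F a b c = of_nat (((a + b + c) choose a) * ((b + c) choose b)) * f c * g b * h a"
    for a b c
  have c: "(k choose j) * (j choose i) = (k choose i) * ((k - i) choose (j - i))"
    if "i \<le> j" "j \<le> k" for i j
    using that by (rule choose_mult)
  have "M f (M g h) k =
      (\<Sum>j=0..k. \<Sum>i=0..j. of_nat ((k choose j) * (j choose i)) * f (k - j) * g (j - i) * h i)"
    by (simp add: M_def sum_distrib_left sum_distrib_right mult_ac atMost_atLeast0)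
  also have "\<dots> = (\<Sum>j=0..k. \<Sum>i=0..j. F i (j - i) (k - j))"
    by (intro sum.cong refl) (simp add: F_def c)
  also have "\<dots> = (\<Sum>j=0..k. \<Sum>i=0..k - j. F j i (k - j - i))"
    by (rule fps_mult_assoc_lemma)
  also have "\<dots> = M (M f g) h k"
    by (simp add: M_def F_def sum_distrib_left sum_distrib_right mult_ac atMost_atLeast0)
  finally have "M f (M g h) k = M (M f g) h k" .
  moreover have "dp_mult n (dp_mult n f g) h k = (if k < CHAR('a) ^ n then M (M f g) h k else 0)"
    by (auto simp: dp_mult_def M_def intro!: sum.cong)
  moreover have "dp_mult n f (dp_mult n g h) k = (if k < CHAR('a) ^ n then M f (M g h) k else 0)"
    by (auto simp: dp_mult_def M_def intro!: sum.cong)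
  ultimately show "dp_mult n (dp_mult n f g) h k = dp_mult n f (dp_mult n g h) k"
    by simp
qed

lemma dp_deriv_basis:
  "dp_deriv (dp_basis i) = (if i = 0 then (\<lambda>_. 0) else dp_basis (i - 1))"
  by (auto simp: dp_deriv_def dp_basis_def fun_eq_iff)

text \<open>
  The element \<open>f \<partial>\<close> of the Zassenhaus algebra is represented by the coefficient function of \<open>f\<close>.
\<close>

definition zassenhaus :: "nat \<Rightarrow> ('a::field, nat \<Rightarrow> 'a) lie_alg" where
  "zassenhaus n =
     \<lparr>vspace = dp_space n,
      vadd = (\<lambda>f g k. f k + g k),
      vscale = (\<lambda>c f k. c * f k),
      bracket = (\<lambda>f g k. dp_mult n f (dp_deriv g) k - dp_mult n (dp_deriv f) g k)\<rparr>"

text \<open>\<open>zassenhaus_basis i\<close> is \<open>e\<^sub>i\<close>; it is only meaningful for \<open>i \<ge> -1\<close>.\<close>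

definition zassenhaus_basis :: "int \<Rightarrow> nat \<Rightarrow> 'a::field" where
  "zassenhaus_basis i = dp_basis (nat (i + 1))"

definition zassenhaus_mult :: "nat \<Rightarrow> (nat \<Rightarrow> 'a::field) monoid" where
  "zassenhaus_mult n =
     \<lparr>carrier = dp_space n, mult = dp_mult n, one = zassenhaus_basis (-1)\<rparr>"

lemma comm_monoid_zassenhaus_mult:
  assumes "CHAR('a::field) > 0"
  shows "comm_monoid (zassenhaus_mult n :: (nat \<Rightarrow> 'a) monoid)"
  using assms
  by (intro comm_monoidI)
     (auto simp: zassenhaus_mult_def zassenhaus_basis_def dp_mult_in_space dp_basis_in_space
        dp_mult_assoc dp_mult_one_left intro: dp_mult_commute)

definition zassenhaus_tp :: "nat \<Rightarrow> (nat \<Rightarrow> 'a::field) \<Rightarrow> ('a, nat \<Rightarrow> 'a) tp_alg" where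
  "zassenhaus_tp n q =
     lie_alg.extend (zassenhaus n)
       (tp_alg.fields (\<lambda>x y. x \<otimes>\<^bsub>zassenhaus_mult n\<^esub> q \<otimes>\<^bsub>zassenhaus_mult n\<^esub> y))"

lemma zassenhaus_tp_simps:
  "vspace (zassenhaus_tp n q) = dp_space n"
  "vadd (zassenhaus_tp n q) = vadd (zassenhaus n)"
  "vscale (zassenhaus_tp n q) = vscale (zassenhaus n)"
  "bracket (zassenhaus_tp n q) = bracket (zassenhaus n)"
  "tp_mult (zassenhaus_tp n q) x y = dp_mult n (dp_mult n x q) y"
  by (simp_all add: zassenhaus_tp_def zassenhaus_def zassenhaus_mult_def
        lie_alg.defs tp_alg.defs)

end

theory Submission
  imports Defs
begin

text \<open>
  Multiplications by elements of \<open>\<O>(1;n)\<close> are the only linear maps \<open>D\<close> of \<open>\<W>(1;n)\<close> with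
  \<open>2 D [x, y] = [D x, y] + [x, D y]\<close>. This characterizes them in terms of the Lie bracket alone, so
  conjugation by a Lie automorphism \<open>\<Psi>\<close> permutes them: every \<open>f\<close> has a \<open>g\<close> with
  \<open>\<Psi> (f \<bullet> x) = g \<bullet> \<Psi> x\<close> for all \<open>x\<close>. With \<open>x = e\<^sub>-\<^sub>1\<close> and \<open>u = \<Psi> e\<^sub>-\<^sub>1\<close>, surjectivity of \<open>\<Psi>\<close> makes
  \<open>u\<close> invertible, and \<open>\<Psi> f = g \<bullet> u\<close> gives \<open>\<Psi> (f \<bullet> x) \<bullet> u = \<Psi> f \<bullet> \<Psi> x\<close>. Hence
  \<open>\<Psi> (x \<bullet> q \<bullet> y) = \<Psi> x \<bullet> (u\<^sup>-\<^sup>2 \<bullet> \<Psi> q) \<bullet> \<Psi> y\<close>.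
\<close>

section \<open>Arithmetic of the divided powers algebra\<close>

text \<open>By the absorption identity, \<open>j * (p ^ n choose j)\<close> is a multiple of
  \<open>p ^ n\<close>. Were the binomial prime to \<open>p\<close>, then \<open>p ^ n\<close> would
  divide the smaller positive number \<open>j\<close>.\<close>

lemma prime_dvd_prime_power_choose:
  fixes p :: nat
  assumes "prime p" "0 < j" "j < p ^ n"
  shows "p dvd (p ^ n choose j)"
proof (rule ccontr)
  assume "\<not> p dvd (p ^ n choose j)"
  then have "coprime (p ^ n) (p ^ n choose j)"
    using assms(1) by (simp add: prime_imp_coprime)
  moreover have "p ^ n dvd j * (p ^ n choose j)"
    using assms by (simp add: times_binomial_minus1_eq)
  ultimately have "p ^ n dvd j"
    by (simp add: coprime_dvd_mult_left_iff)
  with assms(2,3) show False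
    by (auto dest: dvd_imp_le)
qed

lemma of_nat_prime_power_choose:
  assumes "CHAR('a::field) > 0" "0 < j" "j < CHAR('a) ^ n"
  shows "of_nat (CHAR('a) ^ n choose j) = (0 :: 'a)"
  using prime_dvd_prime_power_choose[OF prime_CHAR_semidom[OF assms(1)] assms(2,3)]
  by (simp add: of_nat_eq_0_iff_char_dvd)

lemma dp_mult_add_left: "dp_mult n (\<lambda>k. f k + g k) h = (\<lambda>k. dp_mult n f h k + dp_mult n g h k)"
  by (auto simp: dp_mult_def fun_eq_iff algebra_simps sum.distrib)

lemma dp_mult_add_right: "dp_mult n h (\<lambda>k. f k + g k) = (\<lambda>k. dp_mult n h f k + dp_mult n h g k)"
  by (auto simp: dp_mult_def fun_eq_iff algebra_simps sum.distrib)

lemma dp_mult_diff_left: "dp_mult n (\<lambda>k. f k - g k) h = (\<lambda>k. dp_mult n f h k - dp_mult n g h k)"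
  by (auto simp: dp_mult_def fun_eq_iff algebra_simps sum_subtractf)

lemma dp_mult_diff_right: "dp_mult n h (\<lambda>k. f k - g k) = (\<lambda>k. dp_mult n h f k - dp_mult n h g k)"
  by (auto simp: dp_mult_def fun_eq_iff algebra_simps sum_subtractf)

lemma dp_mult_scale_left: "dp_mult n (\<lambda>k. c * f k) h = (\<lambda>k. c * dp_mult n f h k)"
  by (auto simp: dp_mult_def fun_eq_iff sum_distrib_left mult_ac intro!: sum.cong)

lemma dp_mult_scale_right: "dp_mult n h (\<lambda>k. c * f k) = (\<lambda>k. c * dp_mult n h f k)"
  by (auto simp: dp_mult_def fun_eq_iff sum_distrib_left mult_ac intro!: sum.cong)

lemma dp_mult_zero_left: "dp_mult n (\<lambda>_. 0) h = (\<lambda>_. 0)"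
  by (auto simp: dp_mult_def)

lemma dp_mult_zero_right: "dp_mult n h (\<lambda>_. 0) = (\<lambda>_. 0)"
  by (auto simp: dp_mult_def)

lemma dp_mult_left_commute: "dp_mult n f (dp_mult n g h) = dp_mult n g (dp_mult n f h)"
  by (metis dp_mult_assoc dp_mult_commute)

lemma dp_mult_one_right: "f \<in> dp_space n \<Longrightarrow> dp_mult n f (dp_basis 0) = f"
  by (subst dp_mult_commute) (rule dp_mult_one_left)

lemma dp_mult_basis_left:
  "dp_mult n (dp_basis i) g k =
     (if k < CHAR('a) ^ n \<and> i \<le> k then of_nat (k choose i) * g (k - i) else (0 :: 'a::field))"
proof -
  have "(\<Sum>j\<le>k. of_nat (k choose j) * g (k - j) * dp_basis i j) =
        (\<Sum>j\<le>k. if j = i then of_nat (k choose i) * g (k - i) else 0)"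
    by (rule sum.cong) (auto simp: dp_basis_def)
  then show ?thesis
    by (subst dp_mult_commute) (auto simp: dp_mult_def)
qed

text \<open>Pascal's rule gives the Leibniz rule away from the truncation. With
  \<open>p = CHAR('a)\<close>, in degree \<open>p ^ n - 1\<close> the left side is cut to 0; the
  right side vanishes too, since the inner binomials are 0 modulo \<open>p\<close> and the two outer
  terms contain \<open>f (p ^ n)\<close> or \<open>g (p ^ n)\<close>.\<close>

lemma dp_deriv_mult:
  fixes f g :: "nat \<Rightarrow> 'a::field"
  assumes char: "CHAR('a) > 0" and f: "f \<in> dp_space n" and g: "g \<in> dp_space n"
  shows "dp_deriv (dp_mult n f g) = (\<lambda>k. dp_mult n (dp_deriv f) g k + dp_mult n f (dp_deriv g) k)"
proof
  fix k
  define S where "S = (\<Sum>j\<le>Suc k. of_nat (Suc k choose j) * f (Suc k - j) * g j)"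
  have "S = f (Suc k) * g 0 + (\<Sum>j\<le>k. of_nat (k choose Suc j) * f (k - j) * g (Suc j)) +
      (\<Sum>j\<le>k. of_nat (k choose j) * f (k - j) * g (Suc j))"
    unfolding S_def by (subst sum.atMost_Suc_shift) (simp add: algebra_simps sum.distrib)
  also have "f (Suc k) * g 0 + (\<Sum>j\<le>k. of_nat (k choose Suc j) * f (k - j) * g (Suc j)) =
      (\<Sum>j\<le>Suc k. of_nat (k choose j) * f (Suc k - j) * g j)"
    by (subst sum.atMost_Suc_shift) simp
  also have "\<dots> = (\<Sum>j\<le>k. of_nat (k choose j) * f (Suc (k - j)) * g j)"
    by (simp add: Suc_diff_le binomial_eq_0)
  finally have S: "S = (\<Sum>j\<le>k. of_nat (k choose j) * f (Suc (k - j)) * g j) +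
      (\<Sum>j\<le>k. of_nat (k choose j) * f (k - j) * g (Suc j))" .
  have "S = 0" if "Suc k = CHAR('a) ^ n"
    unfolding S_def
  proof (rule sum.neutral, intro ballI)
    fix j assume "j \<in> {..Suc k}"
    then consider "j = 0" | "j = CHAR('a) ^ n" | "0 < j" "j < CHAR('a) ^ n"
      using \<open>Suc k = _\<close> by fastforce
    then show "of_nat (Suc k choose j) * f (Suc k - j) * g j = 0"
      using f g by cases (auto simp: that dp_space_def of_nat_prime_power_choose[OF char])
  qed
  then show "dp_deriv (dp_mult n f g) k =
      dp_mult n (dp_deriv f) g k + dp_mult n f (dp_deriv g) k"
    using S by (cases "Suc k = CHAR('a) ^ n") (auto simp: dp_deriv_def dp_mult_def S_def)
qed

lemma dp_one_in_space: "CHAR('a::field) > 0 \<Longrightarrow> (dp_basis 0 :: nat \<Rightarrow> 'a) \<in> dp_space n"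
  by (simp add: dp_basis_in_space)

lemma dp_space_add: "f \<in> dp_space n \<Longrightarrow> g \<in> dp_space n \<Longrightarrow> (\<lambda>k. f k + g k) \<in> dp_space n"
  by (auto simp: dp_space_def)

lemma dp_space_diff: "f \<in> dp_space n \<Longrightarrow> g \<in> dp_space n \<Longrightarrow> (\<lambda>k. f k - g k) \<in> dp_space n"
  by (auto simp: dp_space_def)

lemma dp_space_scale: "f \<in> dp_space n \<Longrightarrow> (\<lambda>k. c * f k) \<in> dp_space n"
  by (auto simp: dp_space_def)

text \<open>Induction on a bound \<open>m\<close> for the support, peeling off the top coefficient
  each time.\<close>

lemma dp_space_linear_eq_zero:
  fixes D :: "(nat \<Rightarrow> 'a::field) \<Rightarrow> nat \<Rightarrow> 'a"
  assumes add: "\<And>x y. x \<in> dp_space n \<Longrightarrow> y \<in> dp_space n \<Longrightarrow> D (\<lambda>k. x k + y k) = (\<lambda>k. D x k + D y k)"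
    and scale: "\<And>c x. x \<in> dp_space n \<Longrightarrow> D (\<lambda>k. c * x k) = (\<lambda>k. c * D x k)"
    and basis: "\<And>i. i < CHAR('a) ^ n \<Longrightarrow> D (dp_basis i) = (\<lambda>_. 0)"
    and x: "x \<in> dp_space n"
  shows "D x = (\<lambda>_. 0)"
proof -
  have "D x = (\<lambda>_. 0)" if "m \<le> CHAR('a) ^ n" "\<forall>i\<ge>m. x i = 0" for m x
    using that
  proof (induction m arbitrary: x)
    case 0
    then have "x = (\<lambda>k. 0 * x k)" "x \<in> dp_space n"
      by (auto simp: dp_space_def)
    then show ?case
      using scale[of x 0] by simp
  next
    case (Suc m)
    define y where "y = (\<lambda>k. if k = m then 0 else x k)"
    have y: "\<forall>i\<ge>m. y i = 0" "y \<in> dp_space n"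
      using Suc.prems by (auto simp: y_def dp_space_def)
    have b: "(dp_basis m :: nat \<Rightarrow> 'a) \<in> dp_space n"
      using Suc.prems by (intro dp_basis_in_space) auto
    have "x = (\<lambda>k. y k + x m * dp_basis m k)"
      by (auto simp: y_def dp_basis_def)
    then have "D x = (\<lambda>k. D y k + x m * D (dp_basis m) k)"
      using add[OF y(2) dp_space_scale[OF b]] scale[OF b] by metis
    then show ?case
      using Suc.IH[OF _ y(1)] basis[of m] Suc.prems(1) by simp
  qed
  from this[of "CHAR('a) ^ n" x] x show ?thesis
    by (auto simp: dp_space_def)
qed

section \<open>Half-derivations and multiplication operators\<close>

lemma zassenhaus_bracket:
  "bracket (zassenhaus n) f g = (\<lambda>k. dp_mult n f (dp_deriv g) k - dp_mult n (dp_deriv f) g k)"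
  by (simp add: zassenhaus_def)

lemma bracket_in_space: "bracket (zassenhaus n) f g \<in> dp_space n"
  unfolding zassenhaus_bracket by (intro dp_space_diff dp_mult_in_space)

text \<open>The 1/2-derivations of the Lie algebra, with the factor 2 kept on the left to avoid
  division. Conditions are imposed only on \<open>dp_space n\<close>, because values elsewhere are
  irrelevant.\<close>

definition half_derivation :: "nat \<Rightarrow> ((nat \<Rightarrow> 'a::field) \<Rightarrow> nat \<Rightarrow> 'a) \<Rightarrow> bool" where
  "half_derivation n D \<longleftrightarrow>
     (\<forall>x\<in>dp_space n. D x \<in> dp_space n) \<and>
     (\<forall>x\<in>dp_space n. \<forall>y\<in>dp_space n. D (\<lambda>k. x k + y k) = (\<lambda>k. D x k + D y k)) \<and>
     (\<forall>c. \<forall>x\<in>dp_space n. D (\<lambda>k. c * x k) = (\<lambda>k. c * D x k)) \<and>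
     (\<forall>x\<in>dp_space n. \<forall>y\<in>dp_space n.
        (\<lambda>k. 2 * D (bracket (zassenhaus n) x y) k) =
        (\<lambda>k. bracket (zassenhaus n) (D x) y k + bracket (zassenhaus n) x (D y) k))"

text \<open>After the Leibniz rule, the terms with \<open>dp_deriv f\<close> in
  \<open>[f x, y] + [x, f y]\<close> cancel and \<open>2 f [x, y]\<close> remains.\<close>

lemma half_derivation_mult:
  fixes f :: "nat \<Rightarrow> 'a::field"
  assumes "CHAR('a) > 0" "f \<in> dp_space n"
  shows "half_derivation n (dp_mult n f)"
  unfolding half_derivation_def
  using assms
  by (simp add: dp_mult_in_space dp_mult_add_right dp_mult_scale_right zassenhaus_bracket
      dp_mult_diff_right dp_deriv_mult dp_mult_add_left dp_mult_assoc dp_mult_commute dp_mult_left_commute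
      fun_eq_iff algebra_simps)

lemma half_derivation_diff:
  assumes "half_derivation n D" "half_derivation n E"
  shows "half_derivation n (\<lambda>x k. D x k - E x k)"
  using assms unfolding half_derivation_def
  by (auto simp: dp_space_diff zassenhaus_bracket dp_mult_diff_left dp_mult_diff_right 
      dp_deriv_def fun_eq_iff algebra_simps)


section \<open>Half-derivations that kill the unit\<close>

lemma bracket_zero_left: "bracket (zassenhaus n) (\<lambda>_. 0) y = (\<lambda>_. 0)"
  by (simp add: zassenhaus_bracket dp_deriv_def dp_mult_zero_left)

lemma bracket_zero_right: "bracket (zassenhaus n) x (\<lambda>_. 0) = (\<lambda>_. 0)"
  by (simp add: zassenhaus_bracket dp_deriv_def dp_mult_zero_right)

lemma bracket_basis_0_left:
  assumes "y \<in> dp_space n"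
  shows "bracket (zassenhaus n) (dp_basis 0) y = dp_deriv y"
  using dp_mult_one_left[OF dp_deriv_in_space[OF assms]]
  by (simp add: zassenhaus_bracket dp_deriv_basis dp_mult_zero_left)

lemma bracket_basis_1_left:
  assumes "y \<in> dp_space n"
  shows "bracket (zassenhaus n) (dp_basis 1) y = (\<lambda>k. (of_nat k - 1) * y k)"
proof
  fix k
  have "bracket (zassenhaus n) (dp_basis 1) y k = dp_mult n (dp_basis 1) (dp_deriv y) k - y k"
    using assms by (simp add: zassenhaus_bracket dp_deriv_basis dp_mult_one_left)
  also have "dp_mult n (dp_basis 1) (dp_deriv y) k = of_nat k * y k"
    using assms by (cases k) (auto simp: dp_mult_basis_left dp_deriv_def dp_space_def)
  finally show "bracket (zassenhaus n) (dp_basis 1) y k = (of_nat k - 1) * y k"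
    by (simp add: algebra_simps)
qed

text \<open>
  The relation with \<open>e\<^sub>-\<^sub>1\<close> reads \<open>\<partial> (d (i + 1)) = 2 d i\<close>, so each \<open>d i\<close> is constant once its
  predecessors vanish; the relations with \<open>e\<^sub>0\<close> at \<open>i\<close> and \<open>i + 1\<close> then kill the constant. At the top
  index \<open>i = p\<^sup>n - 1\<close> there is no \<open>i + 1\<close>, and \<open>[e\<^sub>1, e\<^bsub>i-2\<^esub>] = 2 e\<^bsub>i-1\<^esub>\<close> is used instead.
\<close>

lemma half_derivation_eq_zero:
  fixes E :: "(nat \<Rightarrow> 'a::field) \<Rightarrow> nat \<Rightarrow> 'a"
  assumes E: "half_derivation n E"
    and E0: "E (dp_basis 0) = (\<lambda>_. 0)"
    and char: "CHAR('a) > 2" and N: "CHAR('a) ^ n > 4"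
    and x: "x \<in> dp_space n"
  shows "E x = (\<lambda>_. 0)"
proof -
  define N where "N = CHAR('a) ^ n"
  define d where "d i = E (dp_basis i)" for i
  have two: "(2::'a) \<noteq> 0"
  proof
    assume "(2::'a) = 0"
    then have "CHAR('a) dvd 2"
      using of_nat_eq_0_iff_char_dvd[of 2, where 'a='a] by simp
    with char show False
      by (auto dest: dvd_imp_le)
  qed
  have N0: "of_nat N = (0::'a)"
    using N char unfolding N_def by (cases n) auto
  have bs: "(dp_basis i :: nat \<Rightarrow> 'a) \<in> dp_space n" if "i < N" for i
    using that by (simp add: N_def dp_basis_in_space)
  have ds: "d i \<in> dp_space n" if "i < N" for i
    using E bs[OF that] by (auto simp: d_def half_derivation_def)
  have scale: "E (\<lambda>k. c * x k) = (\<lambda>k. c * E x k)" if "x \<in> dp_space n" for c x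
    using E that by (auto simp: half_derivation_def)
  have br: "2 * E (bracket (zassenhaus n) (dp_basis i) (dp_basis j)) k =
      bracket (zassenhaus n) (d i) (dp_basis j) k + bracket (zassenhaus n) (dp_basis i) (d j) k"
    if "i < N" "j < N" for i j k
    using E bs[OF that(1)] bs[OF that(2)] unfolding half_derivation_def d_def by metis
  have shift: "d (Suc i) (Suc k) = 2 * d i k" if "Suc i < N" for i k
    using br[of 0 "Suc i" k] that N E0
    by (simp add: bracket_basis_0_left bs ds dp_deriv_basis bracket_zero_left d_def[of 0]
        dp_deriv_def[of "d (Suc i)"]) (simp add: d_def)
  \<comment> \<open>As \<open>d 0 = 0\<close>, the derivative of \<open>d 1\<close> vanishes and
    \<open>d 1\<close> is a constant \<open>c\<close>. It is treated first because it enters every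
    relation with \<open>dp_basis 1\<close>.\<close>
  define c where "c = d 1 0"
  have "d 1 k = c * dp_basis 0 k" for k
    using shift[of 0 "k - 1"] N E0 by (cases k) (auto simp: c_def d_def N_def dp_basis_def)
  then have d1: "d 1 = (\<lambda>k. c * dp_basis 0 k)"
    by auto
  \<comment> \<open>\<open>dp_basis 1\<close> is \<open>e_0\<close>, which acts on degree
    \<open>k\<close> by the scalar \<open>k - 1\<close>. The term with \<open>c\<close> is
    \<open>[d 1, dp_basis i]\<close>.\<close>
  have weight: "2 * (of_nat i - 1) * d i k = c * dp_basis (i - 1) k + (of_nat k - 1) * d i k"
    if "1 \<le> i" "i < N" for i k
  proof -
    have "E (bracket (zassenhaus n) (dp_basis 1) (dp_basis i)) = (\<lambda>k. (of_nat i - 1) * d i k)"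
    proof -
      have "bracket (zassenhaus n) (dp_basis 1) (dp_basis i) =
          (\<lambda>k. (of_nat i - 1) * (dp_basis i k :: 'a))"
        unfolding bracket_basis_1_left[OF bs[OF that(2)]] by (auto simp: dp_basis_def)
      then show ?thesis
        by (simp add: scale bs that d_def)
    qed
    moreover have "bracket (zassenhaus n) (d 1) (dp_basis i) = (\<lambda>k. c * dp_basis (i - 1) k)"
      using that unfolding d1 zassenhaus_bracket
      by (auto simp: dp_mult_scale_left dp_mult_one_left dp_deriv_in_space bs dp_deriv_basis)
        (auto simp: dp_deriv_def dp_basis_def dp_mult_zero_left)
    ultimately show ?thesis
      using br[of 1 i k] that N by (simp add: bracket_basis_1_left[unfolded One_nat_def] ds algebra_simps)
  qed
  \<comment> \<open>The two relations say \<open>3 * c = 0\<close> and \<open>11 * c = 0\<close>.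
    The first is void in characteristic 3, but \<open>4 * 3 - 11 = 1\<close> settles all
    characteristics at once. Index 3 is available since \<open>N > 4\<close>.\<close>
  have c0: "c = 0"
  proof -
    have "d 2 1 = 2 * c" "d 3 2 = 4 * c"
      using shift[of 1 0] shift[of 2 1] N by (auto simp: c_def N_def numeral_eq_Suc)
    then have "4 * c = c" "16 * c = 5 * c"
      using weight[of 2 1] weight[of 3 2] N
      by (auto simp: N_def dp_basis_def algebra_simps)
    then have eq: "4 * c - c = 0" "16 * c - 5 * c = 0"
      by (simp_all only: right_minus_eq)
    have "c = 4 * (4 * c - c) - (16 * c - 5 * c)"
      by algebra
    also have "\<dots> = 0"
      by (simp only: eq mult_zero_right diff_zero)
    finally show ?thesis .
  qed
  have "d i = (\<lambda>_. 0)" if "i < N" for i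
    using that
  proof (induction i rule: less_induct)
    case (less i)
    consider "i = 0" | "i = 1" | "2 \<le> i" "Suc i < N" | "2 \<le> i" "Suc i = N"
      using less.prems by linarith
    then show ?case
    proof cases
      case 1
      then show ?thesis by (simp add: d_def E0)
    next
      case 2
      then show ?thesis using d1 c0 by simp
    next
      case 3
      have const: "d i (Suc k) = 0" for k
        using shift[of "i - 1" k] less.IH[of "i - 1"] less.prems 3 by simp
      \<comment> \<open>\<open>eq1\<close> gives nothing when \<open>2 * i = 1\<close> in the field.
        Subtracting twice \<open>eq1\<close> from \<open>eq2\<close> leaves \<open>2 * d i 0\<close>
        whatever \<open>i\<close> is.\<close>
      have eq1: "(2 * of_nat i - 1) * d i 0 = 0"
        using weight[of i 0] 3 c0 by (simp add: algebra_simps)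
      have eq2: "2 * of_nat i * (2 * d i 0) = 0"
        using weight[of "Suc i" 1] shift[of i 0] 3 c0 by simp
      have "2 * d i 0 = 2 * of_nat i * (2 * d i 0) - 2 * ((2 * of_nat i - 1) * d i 0)"
        by (simp add: algebra_simps)
      also have "\<dots> = 0"
        by (simp only: eq1 eq2 mult_zero_right diff_zero)
      finally have "2 * d i 0 = 0" .
      then have "d i 0 = 0"
        using two by simp
      with const show ?thesis
        by (intro ext) (metis nat.exhaust)
    next
      case 4
      \<comment> \<open>This puts both 2 and \<open>i - 1\<close> below \<open>i\<close>, within
        reach of the induction hypothesis.\<close>
      have i: "4 \<le> i" using 4 N by (simp add: N_def)
      have "of_nat (Suc i) = (0::'a)"
        using 4 N0 by simp
      then have m1: "of_nat i = (-1::'a)"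
        by (simp add: add_eq_0_iff)
      \<comment> \<open>Since \<open>i = -1\<close> in the field, \<open>i choose 2\<close> becomes
        \<open>(-1) * (-2) / 2 = 1\<close>; the identity is kept doubled until 2 can be cancelled in
        the field.\<close>
      have "2 * (i choose 2) = i * (i - 1)"
        using i times_binomial_minus1_eq[of 2 i] by simp
      then have "of_nat (2 * (i choose 2)) = (of_nat (i * (i - 1)) :: 'a)"
        by (rule arg_cong)
      then have "2 * of_nat (i choose 2) = (of_nat i * of_nat (i - 1) :: 'a)"
        by (simp only: of_nat_mult of_nat_numeral)
      also have "\<dots> = 2 * 1"
        using i by (simp add: of_nat_diff m1)
      finally have ch: "of_nat (i choose 2) = (1::'a)"
        using two by simp
      \<comment> \<open>The coefficient is \<open>(i choose 2) - i = 1 - (-1)\<close>, which is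
        nonzero.\<close>
      have "bracket (zassenhaus n) (dp_basis 2) (dp_basis (i - 1)) = (\<lambda>k. 2 * (dp_basis i k :: 'a))"
      proof -
        have idx: "2 + (i - 2) = i" "1 + (i - 1) = i"
          using i by auto
        have "dp_mult n (dp_basis 2) (dp_basis (i - 2)) = (dp_basis i :: nat \<Rightarrow> 'a)"
          unfolding dp_mult_basis idx using i less.prems binomial_symmetric[of 2 i] ch
          by (simp add: N_def)
        moreover have "dp_mult n (dp_basis 1) (dp_basis (i - 1)) = (\<lambda>k. - dp_basis i k :: 'a)"
          unfolding dp_mult_basis idx using i less.prems binomial_symmetric[of 1 i] m1
          by (simp add: N_def)
        ultimately show ?thesis
          using i by (simp add: zassenhaus_bracket dp_deriv_basis numeral_2_eq_2)
      qed
      then have "E (bracket (zassenhaus n) (dp_basis 2) (dp_basis (i - 1))) = (\<lambda>k. 2 * d i k)"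
        by (simp add: scale bs less.prems d_def)
      moreover have "d 2 = (\<lambda>_. 0)" "d (i - 1) = (\<lambda>_. 0)"
        using less.IH[of 2] less.IH[of "i - 1"] i less.prems by auto
      ultimately have "2 * (2 * d i k) = 0" for k
        using br[of 2 "i - 1" k] i less.prems
        by (simp add: bracket_zero_left bracket_zero_right)
      then have "d i k = 0" for k
        using two by (simp only: mult_eq_0_iff) blast
      then show ?thesis
        by (rule ext)
    qed
  qed
  then show ?thesis
    using E by (intro dp_space_linear_eq_zero[OF _ scale _ x])
      (simp_all add: half_derivation_def d_def N_def)
qed

text \<open>Subtracting multiplication by \<open>D (dp_basis 0)\<close> leaves a half-derivation
  that kills the unit, hence zero.\<close>

lemma half_derivation_imp_mult:
  fixes D :: "(nat \<Rightarrow> 'a::field) \<Rightarrow> nat \<Rightarrow> 'a"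
  assumes D: "half_derivation n D"
    and char: "CHAR('a) > 2" and N: "CHAR('a) ^ n > 4"
    and x: "x \<in> dp_space n"
  shows "D x = dp_mult n (D (dp_basis 0)) x"
proof -
  have f: "D (dp_basis 0) \<in> dp_space n"
    using D char dp_one_in_space[of n, where 'a='a] by (auto simp: half_derivation_def)
  have "(\<lambda>k. D x k - dp_mult n (D (dp_basis 0)) x k) = (\<lambda>_. 0)"
  proof (rule half_derivation_eq_zero[OF _ _ char N x])
    show "half_derivation n (\<lambda>x k. D x k - dp_mult n (D (dp_basis 0)) x k)"
      using char f by (intro half_derivation_diff half_derivation_mult D) auto
  qed (simp add: dp_mult_one_right f)
  then show ?thesis
    by (metis eq_iff_diff_eq_0 ext)
qed

section \<open>Lie automorphisms and the associative product\<close>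

lemma lie_aut_zassenhausD:
  assumes "\<Psi> \<in> lie_aut (zassenhaus n)"
  shows "bij_betw \<Psi> (dp_space n) (dp_space n)"
    and "x \<in> dp_space n \<Longrightarrow> y \<in> dp_space n \<Longrightarrow> \<Psi> (\<lambda>k. x k + y k) = (\<lambda>k. \<Psi> x k + \<Psi> y k)"
    and "x \<in> dp_space n \<Longrightarrow> \<Psi> (\<lambda>k. c * x k) = (\<lambda>k. c * \<Psi> x k)"
    and "x \<in> dp_space n \<Longrightarrow> y \<in> dp_space n \<Longrightarrow>
      \<Psi> (bracket (zassenhaus n) x y) = bracket (zassenhaus n) (\<Psi> x) (\<Psi> y)"
  using assms by (simp_all add: lie_aut_def lie_iso_def zassenhaus_def)

text \<open>Half-derivations are defined by the linear structure and the bracket alone, and both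
  \<Psi> and its inverse \<Theta> on \<open>dp_space n\<close> preserve these.\<close>

lemma half_derivation_conj:
  assumes \<Psi>: "\<Psi> \<in> lie_aut (zassenhaus n)" and D: "half_derivation n D"
  shows "half_derivation n (\<lambda>y. \<Psi> (D (inv_into (dp_space n) \<Psi> y)))"
proof -
  note aut = lie_aut_zassenhausD[OF \<Psi>]
  define \<Theta> where "\<Theta> = inv_into (dp_space n) \<Psi>"
  have \<Psi>s: "\<Psi> x \<in> dp_space n" if "x \<in> dp_space n" for x
    using aut(1) that by (auto simp: bij_betw_def)
  have \<Theta>s: "\<Theta> y \<in> dp_space n" and \<Psi>\<Theta>: "\<Psi> (\<Theta> y) = y" if "y \<in> dp_space n" for y
    using aut(1) that unfolding \<Theta>_def
    by (auto simp: bij_betw_def f_inv_into_f intro: inv_into_into)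
  have \<Theta>\<Psi>: "\<Theta> (\<Psi> x) = x" if "x \<in> dp_space n" for x
    using aut(1) that unfolding \<Theta>_def by (auto simp: bij_betw_def)
  have \<Theta>_add: "\<Theta> (\<lambda>k. x k + y k) = (\<lambda>k. \<Theta> x k + \<Theta> y k)"
    if "x \<in> dp_space n" "y \<in> dp_space n" for x y
    using aut(2)[of "\<Theta> x" "\<Theta> y"] \<Theta>\<Psi>[OF dp_space_add[OF \<Theta>s[OF that(1)] \<Theta>s[OF that(2)]]]
    by (simp add: \<Theta>s \<Psi>\<Theta> that)
  have \<Theta>_scale: "\<Theta> (\<lambda>k. c * x k) = (\<lambda>k. c * \<Theta> x k)" if "x \<in> dp_space n" for c x
    using aut(3)[of "\<Theta> x" c] \<Theta>\<Psi>[OF dp_space_scale[OF \<Theta>s[OF that]], of c]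
    by (simp add: \<Theta>s \<Psi>\<Theta> that)
  have \<Theta>_bracket: "\<Theta> (bracket (zassenhaus n) x y) = bracket (zassenhaus n) (\<Theta> x) (\<Theta> y)"
    if "x \<in> dp_space n" "y \<in> dp_space n" for x y
    using aut(4)[of "\<Theta> x" "\<Theta> y"] \<Theta>\<Psi>[OF bracket_in_space, of "\<Theta> x" "\<Theta> y"]
    by (simp add: \<Theta>s \<Psi>\<Theta> that)
  have D_space: "D x \<in> dp_space n"
    and D_add: "y \<in> dp_space n \<Longrightarrow> D (\<lambda>k. x k + y k) = (\<lambda>k. D x k + D y k)"
    and D_scale: "D (\<lambda>k. c * x k) = (\<lambda>k. c * D x k)"
    and D_bracket: "y \<in> dp_space n \<Longrightarrow> (\<lambda>k. 2 * D (bracket (zassenhaus n) x y) k) =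
      (\<lambda>k. bracket (zassenhaus n) (D x) y k + bracket (zassenhaus n) x (D y) k)"
    if "x \<in> dp_space n" for x y c
    using D that by (auto simp: half_derivation_def)
  have "(\<lambda>k. 2 * \<Psi> (D (\<Theta> (bracket (zassenhaus n) x y))) k) =
      (\<lambda>k. bracket (zassenhaus n) (\<Psi> (D (\<Theta> x))) y k + bracket (zassenhaus n) x (\<Psi> (D (\<Theta> y))) k)"
    if xy: "x \<in> dp_space n" "y \<in> dp_space n" for x y
  proof -
    have "(\<lambda>k. 2 * \<Psi> (D (\<Theta> (bracket (zassenhaus n) x y))) k) =
        \<Psi> (\<lambda>k. 2 * D (bracket (zassenhaus n) (\<Theta> x) (\<Theta> y)) k)"
      by (simp add: \<Theta>_bracket xy aut(3) D_space bracket_in_space)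
    also have "\<dots> = (\<lambda>k. \<Psi> (bracket (zassenhaus n) (D (\<Theta> x)) (\<Theta> y)) k +
        \<Psi> (bracket (zassenhaus n) (\<Theta> x) (D (\<Theta> y))) k)"
      by (simp add: D_bracket \<Theta>s xy aut(2) bracket_in_space)
    finally show ?thesis
      by (simp add: aut(4) D_space \<Theta>s \<Psi>\<Theta> xy)
  qed
  then show ?thesis
    unfolding half_derivation_def \<Theta>_def[symmetric]
    by (simp add: \<Psi>s \<Theta>s D_space \<Theta>_add \<Theta>_scale D_add D_scale aut(2,3))
qed

text \<open>The conjugate of multiplication by \<open>f\<close> is a half-derivation, so it is
  multiplication by its own value at the unit.\<close>

lemma lie_aut_mult:
  fixes \<Psi> :: "(nat \<Rightarrow> 'a::field) \<Rightarrow> nat \<Rightarrow> 'a"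
  assumes \<Psi>: "\<Psi> \<in> lie_aut (zassenhaus n)"
    and char: "CHAR('a) > 2" and N: "CHAR('a) ^ n > 4"
    and f: "f \<in> dp_space n"
  obtains g where "g \<in> dp_space n" "\<And>x. x \<in> dp_space n \<Longrightarrow> \<Psi> (dp_mult n f x) = dp_mult n g (\<Psi> x)"
proof -
  define D where "D = (\<lambda>y. \<Psi> (dp_mult n f (inv_into (dp_space n) \<Psi> y)))"
  note bij = lie_aut_zassenhausD(1)[OF \<Psi>]
  have D: "half_derivation n D"
    unfolding D_def using char f by (intro half_derivation_conj \<Psi> half_derivation_mult) auto
  show thesis
  proof
    show "D (dp_basis 0) \<in> dp_space n"
      using D char dp_one_in_space[of n, where 'a='a] by (auto simp: half_derivation_def)
    show "\<Psi> (dp_mult n f x) = dp_mult n (D (dp_basis 0)) (\<Psi> x)" if "x \<in> dp_space n" for x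
      using half_derivation_imp_mult[OF D char N, of "\<Psi> x"] bij that
      by (auto simp: D_def bij_betw_def)
  qed
qed

text \<open>With \<open>u\<close> the image of the unit and \<open>g\<close> the partner of
  \<open>f\<close>, both sides equal \<open>g u (\<Psi> x)\<close>. Thus \<Psi> is multiplicative up
  to one factor \<open>u\<close>.\<close>

lemma lie_aut_mult_unit:
  fixes \<Psi> :: "(nat \<Rightarrow> 'a::field) \<Rightarrow> nat \<Rightarrow> 'a"
  assumes \<Psi>: "\<Psi> \<in> lie_aut (zassenhaus n)"
    and char: "CHAR('a) > 2" and N: "CHAR('a) ^ n > 4"
    and f: "f \<in> dp_space n" and x: "x \<in> dp_space n"
  shows "dp_mult n (\<Psi> (dp_mult n f x)) (\<Psi> (dp_basis 0)) = dp_mult n (\<Psi> f) (\<Psi> x)"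
proof -
  have one: "(dp_basis 0 :: nat \<Rightarrow> 'a) \<in> dp_space n"
    using char by (intro dp_one_in_space) auto
  obtain g where g: "\<And>x. x \<in> dp_space n \<Longrightarrow> \<Psi> (dp_mult n f x) = dp_mult n g (\<Psi> x)"
    using lie_aut_mult[OF \<Psi> char N f] by blast
  have "\<Psi> f = dp_mult n g (\<Psi> (dp_basis 0))"
    using g[OF one] by (simp add: dp_mult_one_right f)
  then show ?thesis
    by (simp add: g x dp_mult_assoc dp_mult_commute dp_mult_left_commute)
qed

text \<open>For \<open>f\<close> the preimage of the unit, the partner \<open>g\<close> of
  \<open>f\<close> is the inverse sought.\<close>

lemma lie_aut_unit:
  fixes \<Psi> :: "(nat \<Rightarrow> 'a::field) \<Rightarrow> nat \<Rightarrow> 'a"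
  assumes \<Psi>: "\<Psi> \<in> lie_aut (zassenhaus n)"
    and char: "CHAR('a) > 2" and N: "CHAR('a) ^ n > 4"
  shows "\<Psi> (dp_basis 0) \<in> Units (zassenhaus_mult n)"
proof -
  note bij = lie_aut_zassenhausD(1)[OF \<Psi>]
  have one: "(dp_basis 0 :: nat \<Rightarrow> 'a) \<in> dp_space n"
    using char by (intro dp_one_in_space) auto
  obtain f where f: "f \<in> dp_space n" "\<Psi> f = dp_basis 0"
    using bij one unfolding bij_betw_def by (metis imageE)
  obtain g where g: "g \<in> dp_space n" "\<Psi> (dp_mult n f (dp_basis 0)) = dp_mult n g (\<Psi> (dp_basis 0))"
    using lie_aut_mult[OF \<Psi> char N f(1)] one by blast
  have "dp_mult n g (\<Psi> (dp_basis 0)) = dp_basis 0"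
    using g(2) f by (simp add: dp_mult_one_right)
  moreover have "\<Psi> (dp_basis 0) \<in> dp_space n"
    using bij one by (auto simp: bij_betw_def)
  moreover from calculation(1) have "dp_mult n (\<Psi> (dp_basis 0)) g = dp_basis 0"
    by (simp only: dp_mult_commute)
  ultimately show ?thesis
    using g(1) unfolding Units_def zassenhaus_mult_def zassenhaus_basis_def
    by simp blast
qed

section \<open>The isomorphism criterion\<close>

theorem proposition4p5:
  fixes n :: nat and q q' :: "nat \<Rightarrow> 'a::alg_closed_field"
  assumes "CHAR('a) > 2" and "n \<ge> 1" and "(CHAR('a), n) \<noteq> (3, 1)"
    and "q \<in> vspace (zassenhaus n)" and "q' \<in> vspace (zassenhaus n)"
  shows "tp_isomorphic (zassenhaus_tp n q) (zassenhaus_tp n q') \<longleftrightarrow>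
    (\<exists>\<Psi> \<in> lie_aut (zassenhaus n :: ('a, nat \<Rightarrow> 'a) lie_alg).
       q' = (\<Psi> (zassenhaus_basis (-1)) [^]\<^bsub>zassenhaus_mult n\<^esub> (-2::int))
              \<otimes>\<^bsub>zassenhaus_mult n\<^esub> \<Psi> q)"
proof -
  let ?M = "zassenhaus_mult n :: (nat \<Rightarrow> 'a) monoid"
  let ?one = "dp_basis 0 :: nat \<Rightarrow> 'a"
  note char = assms(1)
  have q: "q \<in> dp_space n" and q': "q' \<in> dp_space n"
    using assms(4,5) by (simp_all add: zassenhaus_def)
  \<comment> \<open>The excluded pair \<open>(3, 1)\<close> is the only one violating this bound: in
    characteristic 3 the exponent is at least 2, and any other odd prime is at least 5.\<close>
  have N: "CHAR('a) ^ n > 4"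
  proof (cases "CHAR('a) = 3")
    case True
    then have "(3::nat) ^ 2 \<le> CHAR('a) ^ n"
      using assms(2,3) unfolding True by (intro power_increasing) auto
    then show ?thesis by simp
  next
    case False
    moreover have "odd CHAR('a)"
      using char prime_CHAR_semidom[where 'a='a] by (intro prime_odd_nat) auto
    then have "CHAR('a) \<noteq> 4"
      by auto
    moreover have "CHAR('a) \<le> CHAR('a) ^ n"
      using char assms(2) by (intro self_le_power) auto
    ultimately show ?thesis
      using char by linarith
  qed
  have one: "?one \<in> dp_space n"
    using char by (intro dp_one_in_space) auto
  interpret comm_monoid ?M
    using char by (intro comm_monoid_zassenhaus_mult) auto
  have car: "carrier ?M = dp_space n" and mu: "x \<otimes>\<^bsub>?M\<^esub> y = dp_mult n x y"
    and on: "\<one>\<^bsub>?M\<^esub> = ?one" for x y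
    by (simp_all add: zassenhaus_mult_def zassenhaus_basis_def)
  \<comment> \<open>For a fixed Lie automorphism, both conditions are equivalent to
    \<open>u u q' = \<Psi> q\<close>, where \<open>u\<close> is the image of the unit.\<close>
  have iff: "(\<forall>x\<in>dp_space n. \<forall>y\<in>dp_space n.
        \<Psi> (dp_mult n (dp_mult n x q) y) = dp_mult n (dp_mult n (\<Psi> x) q') (\<Psi> y)) \<longleftrightarrow>
      q' = (\<Psi> (zassenhaus_basis (-1)) [^]\<^bsub>?M\<^esub> (-2::int)) \<otimes>\<^bsub>?M\<^esub> \<Psi> q"
    (is "?hom \<longleftrightarrow> ?eq")
    if \<Psi>: "\<Psi> \<in> lie_aut (zassenhaus n)" for \<Psi> :: "(nat \<Rightarrow> 'a) \<Rightarrow> nat \<Rightarrow> 'a"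
  proof -
    define u where "u = \<Psi> ?one"
    have U: "u \<in> Units ?M"
      unfolding u_def by (rule lie_aut_unit[OF \<Psi> char N])
    have \<Psi>s: "\<Psi> x \<in> dp_space n" if "x \<in> dp_space n" for x
      using lie_aut_zassenhausD(1)[OF \<Psi>] that by (auto simp: bij_betw_def)
    have us: "u \<in> dp_space n"
      using \<Psi>s one by (simp add: u_def)
    \<comment> \<open>A negative integer power is the inverse of a natural power, so
      \<open>v\<close> is \<open>u\<close> to the power -2.\<close>
    define v where "v = inv\<^bsub>?M\<^esub> (u \<otimes>\<^bsub>?M\<^esub> u)"
    have v: "v \<in> dp_space n" "dp_mult n v (dp_mult n u u) = ?one"
      using U by (simp_all add: v_def flip: car mu on)
    have cancel: "dp_mult n v (dp_mult n (dp_mult n u u) x) = x" if "x \<in> dp_space n" for x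
      using v(2) that by (simp add: dp_mult_one_left flip: dp_mult_assoc)
    have pow: "u [^]\<^bsub>?M\<^esub> (-2::int) = v"
      using us by (simp add: int_pow_def2 v_def numeral_2_eq_2 car nat_pow_Suc dp_mult_one_left flip: on)
    have eq_iff: "?eq \<longleftrightarrow> dp_mult n (dp_mult n u u) q' = \<Psi> q"
    proof
      assume ?eq
      then have "q' = dp_mult n v (\<Psi> q)"
        by (simp add: zassenhaus_basis_def pow mu flip: u_def)
      then show "dp_mult n (dp_mult n u u) q' = \<Psi> q"
        using cancel[OF \<Psi>s[OF q]] by (simp add: dp_mult_left_commute)
    next
      assume "dp_mult n (dp_mult n u u) q' = \<Psi> q"
      then show ?eq
        using cancel[OF q'] by (simp add: zassenhaus_basis_def pow mu flip: u_def)
    qed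
    show ?thesis
      unfolding eq_iff
    proof
      assume ?hom
      \<comment> \<open>Specialization to \<open>x = y = ?one\<close> already recovers the equation
        for \<open>q'\<close>.\<close>
      then have "\<Psi> (dp_mult n (dp_mult n ?one q) ?one) = dp_mult n (dp_mult n u q') u"
        using one by (simp add: u_def)
      then show "dp_mult n (dp_mult n u u) q' = \<Psi> q"
        using q by (simp add: dp_mult_one_left dp_mult_one_right dp_mult_assoc dp_mult_commute
            dp_mult_left_commute)
    next
      assume eq: "dp_mult n (dp_mult n u u) q' = \<Psi> q"
      show ?hom
      proof (intro ballI)
        fix x y :: "nat \<Rightarrow> 'a" assume x: "x \<in> dp_space n" and y: "y \<in> dp_space n"
        let ?z = "\<Psi> (dp_mult n (dp_mult n x q) y)"
        \<comment> \<open>The two factors \<open>u\<close> pay for two uses of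
          \<open>lie_aut_mult_unit\<close>: one splits off \<open>y\<close>, the other separates
          \<open>x\<close> from \<open>q\<close>. Multiplying by \<open>v\<close> then cancels
          them.\<close>
        have zu: "dp_mult n ?z u = dp_mult n (\<Psi> (dp_mult n x q)) (\<Psi> y)"
          unfolding u_def by (rule lie_aut_mult_unit[OF \<Psi> char N dp_mult_in_space y])
        have xq: "dp_mult n (\<Psi> (dp_mult n x q)) u = dp_mult n (\<Psi> x) (\<Psi> q)"
          unfolding u_def by (rule lie_aut_mult_unit[OF \<Psi> char N x q])
        have "dp_mult n (dp_mult n u u) ?z = dp_mult n u (dp_mult n ?z u)"
          by (simp add: dp_mult_assoc dp_mult_commute)
        also have "\<dots> = dp_mult n (dp_mult n (\<Psi> (dp_mult n x q)) u) (\<Psi> y)"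
          unfolding zu by (simp add: dp_mult_assoc dp_mult_left_commute)
        also have "\<dots> = dp_mult n (dp_mult n (\<Psi> x) (\<Psi> q)) (\<Psi> y)"
          unfolding xq ..
        also have "\<dots> = dp_mult n (dp_mult n u u) (dp_mult n (dp_mult n (\<Psi> x) q') (\<Psi> y))"
          unfolding eq[symmetric]
          by (simp add: dp_mult_assoc dp_mult_commute dp_mult_left_commute)
        finally have "dp_mult n v (dp_mult n (dp_mult n u u) ?z) =
            dp_mult n v (dp_mult n (dp_mult n u u) (dp_mult n (dp_mult n (\<Psi> x) q') (\<Psi> y)))"
          by (rule arg_cong)
        then show "?z = dp_mult n (dp_mult n (\<Psi> x) q') (\<Psi> y)"
          by (simp only: cancel \<Psi>s dp_mult_in_space)
      qed
    qed
  qed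
  \<comment> \<open>Both algebras have the same underlying Lie algebra, so an isomorphism is a Lie
    automorphism that meets the left side of \<open>iff\<close>.\<close>
  have "tp_iso (zassenhaus_tp n q) (zassenhaus_tp n q') \<Psi> \<longleftrightarrow>
      \<Psi> \<in> lie_aut (zassenhaus n) \<and>
      (\<forall>x\<in>dp_space n. \<forall>y\<in>dp_space n.
        \<Psi> (dp_mult n (dp_mult n x q) y) = dp_mult n (dp_mult n (\<Psi> x) q') (\<Psi> y))"
    for \<Psi> :: "(nat \<Rightarrow> 'a) \<Rightarrow> nat \<Rightarrow> 'a"
    by (simp add: tp_iso_def lie_aut_def lie_iso_def zassenhaus_tp_simps)
      (simp add: zassenhaus_def)
  with iff show ?thesis
    unfolding tp_isomorphic_def by blast
qed

end
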